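(* Let $(S_i,X_i)_{i\ge1}$, $\Upsilon$, $I_{\mathrm i}$, $I_{\mathrm s}$ be as defined in the context. Assume that there exists a positive real function $f$ on $[0,+\infty)$ such that $\lim_{s\uparrow+\infty}f(s)/s=0$ and $\|X_1\|\le f(S_1)$ with full probability. Then $I_{\mathrm i}=I_{\mathrm s}=\Upsilon(1,\cdot\,)$ on $\mathcal{X}$.
   Context: Setting. $(\mathcal{X},\|\cdot\|)$ is a real separable Banach space with Borel $\sigma$-field $\mathcal{B}(\mathcal{X})$ and topological dual $\mathcal{X}^\star$. On a probability space $(\Omega,\mathcal{F},\mathbb{P})$ with expectation $\mathbb{E}$, the pairs $(S_1,X_1),(S_2,X_2),\ldots$ are independent and identically distributed random vectors; the waiting times $S_i$ take positive real values and the rewards $X_i$ take values in $\mathcal{X}$. Any dependence between $S_i$ and $X_i$ is allowed. For $(s,w)\in\mathbb{R}\times\mathcal{X}$ let $$J(s,w):=\sup_{(\zeta,\varphi)\in\mathbb{R}\times\mathcal{X}^\star}\Big\{s\zeta+\varphi(w)-\ln\mathbb{E}\big[e^{\zeta S_1+\varphi(X_1)}\big]\Big\}\in[0,+\infty].$$ With $B_{w,\delta}:=\{v\in\mathcal{X}:\|v-w\|<\delta\}$, for $(\beta,w)\in\mathbb{R}\times\mathcal{X}$ let $$\Upsilon(\beta,w):=\lim_{\delta\downarrow 0}\ \inf_{s\in(\beta-\delta,\beta+\delta)}\ \inf_{v\in B_{w,\delta}}\ \inf_{\gamma>0}\big\{\gamma J(s/\gamma,v/\gamma)\big\}.$$ Let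 $$\ell_{\mathrm i}:=-\liminf_{s\uparrow+\infty}\frac1s\ln\mathbb{P}[S_1>s],\qquad \ell_{\mathrm s}:=-\limsup_{s\uparrow+\infty}\frac1s\ln\mathbb{P}[S_1>s],$$ so that $0\le\ell_{\mathrm s}\le\ell_{\mathrm i}\le+\infty$. For $w\in\mathcal{X}$ define $$I_{\mathrm i}(w):=\begin{cases}\inf_{\beta\in[0,1]}\{\Upsilon(\beta,w)+(1-\beta)\ell_{\mathrm i}\}&\text{if }\ell_{\mathrm i}<+\infty,\\ \Upsilon(1,w)&\text{if }\ell_{\mathrm i}=+\infty,\end{cases}\qquad I_{\mathrm s}(w):=\begin{cases}\inf_{\beta\in[0,1]}\{\Upsilon(\beta,w)+(1-\beta)\ell_{\mathrm s}\}&\text{if }\ell_{\mathrm s}<+\infty,\\ \Upsilon(1,w)&\text{if }\ell_{\mathrm s}=+\infty.\end{cases}$$ Conventions: $\ln 0=-\infty$, $\ln(+\infty)=+\infty$. *)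

theory Defs
  imports "HOL-Probability.Probability"
begin

(* Extended logarithm with the conventions ln 0 = -\<infinity> and ln \<infinity> = \<infinity>. *)
definition eln :: "ennreal \<Rightarrow> ereal" where
  "eln x = (if x = 0 then -\<infinity> else if x = \<top> then \<infinity> else ereal (ln (enn2real x)))"

(* The topological dual of 'a is the type of bounded linear functionals 'a \<Rightarrow>\<^sub>L real. *)
definition cramer_rate ::
  "'w measure \<Rightarrow> ('w \<Rightarrow> real) \<Rightarrow> ('w \<Rightarrow> 'a::real_normed_vector) \<Rightarrow> real \<Rightarrow> 'a \<Rightarrow> ereal" where
  "cramer_rate M T Y s w =
     (SUP (\<zeta>, \<phi>) \<in> (UNIV :: (real \<times> ('a \<Rightarrow>\<^sub>L real)) set).
        ereal (s * \<zeta> + blinfun_apply \<phi> w)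
          - eln (\<integral>\<^sup>+ \<omega>. ennreal (exp (\<zeta> * T \<omega> + blinfun_apply \<phi> (Y \<omega>))) \<partial>M))"

(* The expression under the limit is nonincreasing in \<delta>, so the limit exists in ereal. *)
definition Upsilon ::
  "'w measure \<Rightarrow> ('w \<Rightarrow> real) \<Rightarrow> ('w \<Rightarrow> 'a::real_normed_vector) \<Rightarrow> real \<Rightarrow> 'a \<Rightarrow> ereal" where
  "Upsilon M T Y \<beta> w =
     Lim (at_right (0::real))
       (\<lambda>\<delta>. INF s\<in>{\<beta> - \<delta><..<\<beta> + \<delta>}. INF v\<in>ball w \<delta>. INF \<gamma>\<in>{0<..}.
          ereal \<gamma> * cramer_rate M T Y (s / \<gamma>) (v /\<^sub>R \<gamma>))"

definition tail_rate_inf :: "'w measure \<Rightarrow> ('w \<Rightarrow> real) \<Rightarrow> ereal" where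
  "tail_rate_inf M T =
     - Liminf at_top (\<lambda>s::real. ereal (1 / s) * eln (emeasure M {\<omega> \<in> space M. T \<omega> > s}))"

definition tail_rate_sup :: "'w measure \<Rightarrow> ('w \<Rightarrow> real) \<Rightarrow> ereal" where
  "tail_rate_sup M T =
     - Limsup at_top (\<lambda>s::real. ereal (1 / s) * eln (emeasure M {\<omega> \<in> space M. T \<omega> > s}))"

definition rate_inf ::
  "'w measure \<Rightarrow> ('w \<Rightarrow> real) \<Rightarrow> ('w \<Rightarrow> 'a::real_normed_vector) \<Rightarrow> 'a \<Rightarrow> ereal" where
  "rate_inf M T Y w =
     (if tail_rate_inf M T < \<infinity>
      then INF \<beta>\<in>{0..1}. Upsilon M T Y \<beta> w + ereal (1 - \<beta>) * tail_rate_inf M T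
      else Upsilon M T Y 1 w)"

definition rate_sup ::
  "'w measure \<Rightarrow> ('w \<Rightarrow> real) \<Rightarrow> ('w \<Rightarrow> 'a::real_normed_vector) \<Rightarrow> 'a \<Rightarrow> ereal" where
  "rate_sup M T Y w =
     (if tail_rate_sup M T < \<infinity>
      then INF \<beta>\<in>{0..1}. Upsilon M T Y \<beta> w + ereal (1 - \<beta>) * tail_rate_sup M T
      else Upsilon M T Y 1 w)"

end

theory Submission
  imports Defs
begin

text \<open>
  The function \<open>(\<gamma>, s, v) \<mapsto> \<gamma> J(s/\<gamma>, v/\<gamma>)\<close> is a supremum of linear functions, hence sublinear, so
  \<open>\<Upsilon>(1, w) \<le> \<Upsilon>(\<beta>, w) + (1 - \<beta>) \<Upsilon>(1, 0)\<close> and it suffices to bound \<open>\<Upsilon>(1, 0)\<close> by \<open>\<ell>\<^sub>s\<close>.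
  By Jensen's inequality, \<open>J\<close> at the mean of \<open>(S, X)\<close> conditioned on an event \<open>A\<close> is at most
  \<open>- ln P(A)\<close>. Take \<open>A = {n < S \<le> n + 1}\<close>: for every \<open>c > \<ell>\<^sub>s\<close> there are arbitrarily large \<open>n\<close>
  with \<open>P(A) > exp (- c n)\<close>, and since \<open>\<parallel>X\<parallel> = o(S)\<close> the conditional mean divided by \<open>n\<close> is close to
  \<open>(1, 0)\<close>. This argument avoids convex duality in the Banach space.
\<close>

section \<open>Extended logarithm\<close>

lemma eln_ennreal: "0 < x \<Longrightarrow> eln (ennreal x) = ereal (ln x)"
  by (simp add: eln_def ennreal_eq_0_iff)

lemma eln_mono: "x \<le> y \<Longrightarrow> eln x \<le> eln y"
  by (cases x; cases y) (auto simp: eln_def top_unique ennreal_eq_0_iff)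

section \<open>Sublinearity of the scaled Cramer rate\<close>

context prob_space
begin

lemma nn_integral_exp_pos:
  fixes h :: "'a \<Rightarrow> real"
  assumes [measurable]: "h \<in> borel_measurable M"
  shows "(\<integral>\<^sup>+ x. ennreal (exp (h x)) \<partial>M) > 0"
proof (rule ccontr)
  assume "\<not> ?thesis"
  then have "(\<integral>\<^sup>+ x. ennreal (exp (h x)) \<partial>M) = 0" by simp
  then have "AE x in M. False" by (subst (asm) nn_integral_0_iff_AE) auto
  then show False by simp
qed

lemma eln_nn_integral_exp_neq_MInf:
  fixes h :: "'a \<Rightarrow> real"
  assumes "h \<in> borel_measurable M"
  shows "eln (\<integral>\<^sup>+ x. ennreal (exp (h x)) \<partial>M) \<noteq> -\<infinity>"
  using nn_integral_exp_pos[OF assms] by (auto simp: eln_def)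

lemma measurable_exponent:
  fixes T :: "'a \<Rightarrow> real" and Y :: "'a \<Rightarrow> 'b::{banach, second_countable_topology}"
  assumes [measurable]: "T \<in> borel_measurable M" "Y \<in> borel_measurable M"
  shows "(\<lambda>x. \<zeta> * T x + blinfun_apply \<phi> (Y x)) \<in> borel_measurable M"
proof -
  have [measurable]: "blinfun_apply \<phi> \<in> borel_measurable borel"
    by (intro borel_measurable_continuous_onI continuous_intros)
  show ?thesis by measurable
qed

lemma cramer_rate_nonneg: "0 \<le> cramer_rate M T Y s w"
  unfolding cramer_rate_def
  by (rule SUP_upper2[of "(0, 0)"]) (use eln_ennreal[of 1] in \<open>auto simp: emeasure_space_1\<close>)

text \<open>Multiplying by \<open>\<gamma>\<close> clears every division and moves the logarithmic
  moment to the right-hand side. A bound on the scaled rate thus becomes a family of inequalities,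
  one for each \<open>(\<zeta>, \<phi>)\<close>, that are jointly affine in \<open>\<gamma>\<close>,
  \<open>s\<close>, \<open>v\<close> and \<open>c\<close> and can therefore be added.\<close>

lemma scaled_cramer_rate_le_iff:
  fixes T :: "'a \<Rightarrow> real" and Y :: "'a \<Rightarrow> 'b::{banach, second_countable_topology}"
  assumes meas: "T \<in> borel_measurable M" "Y \<in> borel_measurable M" and "0 < \<gamma>"
  shows "ereal \<gamma> * cramer_rate M T Y (s / \<gamma>) (v /\<^sub>R \<gamma>) \<le> ereal c \<longleftrightarrow>
    (\<forall>\<zeta> \<phi>. ereal (s * \<zeta> + blinfun_apply \<phi> v) \<le> ereal c +
       ereal \<gamma> * eln (\<integral>\<^sup>+ \<omega>. ennreal (exp (\<zeta> * T \<omega> + blinfun_apply \<phi> (Y \<omega>))) \<partial>M))"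
proof -
  have "ereal \<gamma> * cramer_rate M T Y (s / \<gamma>) (v /\<^sub>R \<gamma>) \<le> ereal c \<longleftrightarrow>
     cramer_rate M T Y (s / \<gamma>) (v /\<^sub>R \<gamma>) \<le> ereal (c / \<gamma>)"
    using \<open>0 < \<gamma>\<close>
    by (cases "cramer_rate M T Y (s / \<gamma>) (v /\<^sub>R \<gamma>)") (auto simp: field_simps)
  also have "\<dots> \<longleftrightarrow> (\<forall>\<zeta> \<phi>. ereal (s / \<gamma> * \<zeta> + blinfun_apply \<phi> (v /\<^sub>R \<gamma>))
     - eln (\<integral>\<^sup>+ \<omega>. ennreal (exp (\<zeta> * T \<omega> + blinfun_apply \<phi> (Y \<omega>))) \<partial>M) \<le> ereal (c / \<gamma>))"
    by (simp add: cramer_rate_def SUP_le_iff)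
  also have "\<dots> \<longleftrightarrow> (\<forall>\<zeta> \<phi>. ereal (s * \<zeta> + blinfun_apply \<phi> v) \<le> ereal c +
       ereal \<gamma> * eln (\<integral>\<^sup>+ \<omega>. ennreal (exp (\<zeta> * T \<omega> + blinfun_apply \<phi> (Y \<omega>))) \<partial>M))"
  proof (intro all_cong1)
    fix \<zeta> \<phi>
    show "ereal (s / \<gamma> * \<zeta> + blinfun_apply \<phi> (v /\<^sub>R \<gamma>))
     - eln (\<integral>\<^sup>+ \<omega>. ennreal (exp (\<zeta> * T \<omega> + blinfun_apply \<phi> (Y \<omega>))) \<partial>M) \<le> ereal (c / \<gamma>) \<longleftrightarrow>
     ereal (s * \<zeta> + blinfun_apply \<phi> v) \<le> ereal c +
       ereal \<gamma> * eln (\<integral>\<^sup>+ \<omega>. ennreal (exp (\<zeta> * T \<omega> + blinfun_apply \<phi> (Y \<omega>))) \<partial>M)"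
    proof (cases "eln (\<integral>\<^sup>+ \<omega>. ennreal (exp (\<zeta> * T \<omega> + blinfun_apply \<phi> (Y \<omega>))) \<partial>M)")
      case (real r)
      have "s / \<gamma> * \<zeta> + blinfun_apply \<phi> (v /\<^sub>R \<gamma>) - r = (s * \<zeta> + blinfun_apply \<phi> v - \<gamma> * r) / \<gamma>"
        using \<open>0 < \<gamma>\<close> by (simp add: field_simps blinfun.scaleR_right)
      then show ?thesis
        using \<open>0 < \<gamma>\<close> real by (auto simp: divide_le_cancel)
    qed (use \<open>0 < \<gamma>\<close> eln_nn_integral_exp_neq_MInf[OF measurable_exponent[OF meas, of \<zeta> \<phi>]] in auto)
  qed
  finally show ?thesis .
qed

text \<open>For each fixed \<open>(\<zeta>, \<phi>)\<close> the first affine inequality plus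
  \<open>t\<close> times the second is the required one, since both contain the same logarithmic
  moment \<open>?L\<close>. This is the sublinearity of the scaled rate, stated with upper bounds
  \<open>c\<close> and \<open>c'\<close> so that only finite values are added.\<close>

lemma scaled_cramer_rate_add_le:
  fixes T :: "'a \<Rightarrow> real" and Y :: "'a \<Rightarrow> 'b::{banach, second_countable_topology}"
  assumes meas: "T \<in> borel_measurable M" "Y \<in> borel_measurable M"
    and pos: "0 < \<gamma>" "0 < \<gamma>'" "0 < t"
    and 1: "ereal \<gamma> * cramer_rate M T Y (s / \<gamma>) (v /\<^sub>R \<gamma>) \<le> ereal c"
    and 2: "ereal \<gamma>' * cramer_rate M T Y (s' / \<gamma>') (v' /\<^sub>R \<gamma>') \<le> ereal c'"
  shows "ereal (\<gamma> + t * \<gamma>') *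
     cramer_rate M T Y ((s + t * s') / (\<gamma> + t * \<gamma>')) ((v + t *\<^sub>R v') /\<^sub>R (\<gamma> + t * \<gamma>'))
     \<le> ereal (c + t * c')"
proof -
  have p: "0 < \<gamma> + t * \<gamma>'" using pos by (simp add: add_pos_pos)
  show ?thesis
    unfolding scaled_cramer_rate_le_iff[OF meas p]
  proof (intro allI)
    fix \<zeta> \<phi>
    let ?L = "eln (\<integral>\<^sup>+ \<omega>. ennreal (exp (\<zeta> * T \<omega> + blinfun_apply \<phi> (Y \<omega>))) \<partial>M)"
    have a: "ereal (s * \<zeta> + blinfun_apply \<phi> v) \<le> ereal c + ereal \<gamma> * ?L"
      using 1 unfolding scaled_cramer_rate_le_iff[OF meas pos(1)] by blast
    have b: "ereal (s' * \<zeta> + blinfun_apply \<phi> v') \<le> ereal c' + ereal \<gamma>' * ?L"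
      using 2 unfolding scaled_cramer_rate_le_iff[OF meas pos(2)] by blast
    show "ereal ((s + t * s') * \<zeta> + blinfun_apply \<phi> (v + t *\<^sub>R v'))
        \<le> ereal (c + t * c') + ereal (\<gamma> + t * \<gamma>') * ?L"
    proof (cases ?L)
      case (real r)
      have "s * \<zeta> + blinfun_apply \<phi> v \<le> c + \<gamma> * r" using a real by simp
      moreover have "t * (s' * \<zeta> + blinfun_apply \<phi> v') \<le> t * (c' + \<gamma>' * r)"
        using b real pos by simp
      ultimately show ?thesis
        using real by (simp add: algebra_simps blinfun.add_right blinfun.scaleR_right)
    next
      case PInf
      then show ?thesis using p by simp
    next
      case MInf
      then show ?thesis
        using eln_nn_integral_exp_neq_MInf[OF measurable_exponent[OF meas, of \<zeta> \<phi>]] by simp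
    qed
  qed
qed

section \<open>Jensen bound at conditional means\<close>

text \<open>Restricting the expectation to \<open>A\<close> and applying Jensen's inequality under
  the conditional law gives \<open>exp m * prob A\<close> as a lower bound for the exponential
  moment, where \<open>m\<close> is the conditional mean of the exponent. After taking logarithms,
  \<open>m\<close> cancels against the linear term of the supremum, so the bound is the same for all
  \<open>(\<zeta>, \<phi>)\<close>.\<close>

lemma cramer_rate_conditional_mean_le:
  fixes T :: "'a \<Rightarrow> real" and Y :: "'a \<Rightarrow> 'b::{banach, second_countable_topology}"
  assumes meas: "T \<in> borel_measurable M" "Y \<in> borel_measurable M"
    and A[measurable]: "A \<in> sets M" and pos: "0 < prob A"
    and int: "set_integrable M A T" "set_integrable M A Y"
  shows "cramer_rate M T Y ((LINT x:A|M. T x) / prob A) ((LINT x:A|M. Y x) /\<^sub>R prob A)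
    \<le> ereal (- ln (prob A))"
  unfolding cramer_rate_def
proof (rule SUP_least, clarify)
  fix \<zeta> :: real and \<phi> :: "'b \<Rightarrow>\<^sub>L real"
  let ?h = "\<lambda>x. \<zeta> * T x + blinfun_apply \<phi> (Y x)"
  define m where "m = (LINT x:A|M. T x) / prob A * \<zeta> + blinfun_apply \<phi> ((LINT x:A|M. Y x) /\<^sub>R prob A)"
  have bl: "bounded_linear (blinfun_apply \<phi>)" by (rule blinfun.bounded_linear_right)
  have ih: "integrable M (\<lambda>x. indicator A x * ?h x)"
  proof -
    have "integrable M (\<lambda>x. \<zeta> * (indicator A x *\<^sub>R T x) + blinfun_apply \<phi> (indicator A x *\<^sub>R Y x))"
      using int unfolding set_integrable_def
      by (intro Bochner_Integration.integrable_add integrable_mult_right integrable_bounded_linear[OF bl])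
    then show ?thesis by (simp add: blinfun.scaleR_right algebra_simps)
  qed
  \<comment> \<open>\<open>m\<close> is defined as the linear functional at the mean of the vector;
    linearity of the Bochner integral identifies it with the conditional mean of the scalar exponent
    \<open>?h\<close>.\<close>
  have mean: "(\<integral>x. indicator A x * ?h x \<partial>M) = m * prob A"
  proof -
    have "(\<integral>x. indicator A x * ?h x \<partial>M)
      = (\<integral>x. \<zeta> * (indicator A x *\<^sub>R T x) + blinfun_apply \<phi> (indicator A x *\<^sub>R Y x) \<partial>M)"
      by (simp add: blinfun.scaleR_right algebra_simps)
    also have "\<dots> = \<zeta> * (LINT x:A|M. T x) + blinfun_apply \<phi> (LINT x:A|M. Y x)"
      using int unfolding set_integrable_def set_lebesgue_integral_def
      by (subst Bochner_Integration.integral_add)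
         (auto simp: integral_bounded_linear[OF bl] intro!: integrable_mult_right integrable_bounded_linear[OF bl])
    also have "\<dots> = m * prob A"
      using pos by (simp add: m_def field_simps blinfun.scaleR_right)
    finally show ?thesis .
  qed
  have "ennreal (exp m * prob A) \<le> (\<integral>\<^sup>+ x. ennreal (exp (?h x)) \<partial>M)"
  proof (cases "(\<integral>\<^sup>+ x. ennreal (exp (?h x)) \<partial>M) = \<infinity>")
    case False
    have ie: "integrable M (\<lambda>x. exp (?h x))"
      using False measurable_exponent[OF meas, of \<zeta> \<phi>]
      by (intro integrableI_nonneg) (auto simp: less_top)
    have ii: "integrable M (\<lambda>x. indicator A x * (1 - m))"
      by (intro integrable_mult_left integrable_real_indicator) (auto simp: less_top[symmetric])
    \<comment> \<open>The integrand is the tangent line \<open>exp m * (1 + ?h x - m)\<close> on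
      \<open>A\<close> and 0 elsewhere. Its terms in \<open>m\<close> cancel in the integral, and
      only \<open>exp m * prob A\<close> remains.\<close>
    have "exp m * prob A = (\<integral>x. exp m * (indicator A x * (1 - m) + indicator A x * ?h x) \<partial>M)"
    proof -
      have "(\<integral>x. exp m * (indicator A x * (1 - m) + indicator A x * ?h x) \<partial>M)
        = exp m * ((\<integral>x. indicator A x * (1 - m) \<partial>M) + (\<integral>x. indicator A x * ?h x \<partial>M))"
        by (subst integral_mult_right_zero, subst Bochner_Integration.integral_add[OF ii ih]) (rule refl)
      also have "\<dots> = exp m * prob A"
        unfolding mean integral_mult_left_zero by (simp add: algebra_simps)
      finally show ?thesis ..
    qed
    also have "\<dots> \<le> (\<integral>x. exp (?h x) \<partial>M)"
    proof (rule integral_mono)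
      show "integrable M (\<lambda>x. exp m * (indicator A x * (1 - m) + indicator A x * ?h x))"
        using ii ih by (intro integrable_mult_right Bochner_Integration.integrable_add)
      fix x
      \<comment> \<open>The tangent line of \<open>exp\<close> at the conditional mean \<open>m\<close> of the exponent proves Jensen's inequality.\<close>
      have "exp m * (1 + (?h x - m)) \<le> exp m * exp (?h x - m)"
        by (intro mult_left_mono exp_ge_add_one_self) simp
      also have "\<dots> = exp (?h x)" by (simp flip: exp_add)
      finally show "exp m * (indicator A x * (1 - m) + indicator A x * ?h x) \<le> exp (?h x)"
        by (auto simp: indicator_def algebra_simps)
    qed (rule ie)
    finally show ?thesis
      by (subst nn_integral_eq_integral[OF ie]) (auto intro: ennreal_leI)
  qed simp
  then have "eln (ennreal (exp m * prob A)) \<le> eln (\<integral>\<^sup>+ x. ennreal (exp (?h x)) \<partial>M)"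
    by (rule eln_mono)
  then have "ereal (m + ln (prob A)) \<le> eln (\<integral>\<^sup>+ x. ennreal (exp (?h x)) \<partial>M)"
    using pos by (simp add: eln_ennreal ln_mult)
  then show "ereal ((LINT x:A|M. T x) / prob A * \<zeta> + blinfun_apply \<phi> ((LINT x:A|M. Y x) /\<^sub>R prob A))
     - eln (\<integral>\<^sup>+ x. ennreal (exp (?h x)) \<partial>M) \<le> ereal (- ln (prob A))"
    unfolding m_def[symmetric]
    by (cases "eln (\<integral>\<^sup>+ x. ennreal (exp (?h x)) \<partial>M)") auto
qed

section \<open>Exponential tail rates\<close>

text \<open>Unit windows with probabilities below \<open>exp (- c * real n)\<close> sum to a
  geometric series, so the tail itself decays at rate \<open>c\<close> up to a constant factor. It
  is applied in contrapositive form: for \<open>c\<close> above the tail rate, some arbitrarily late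
  window has probability larger than \<open>exp (- c * real n)\<close>.\<close>

lemma tail_rate_sup_ge:
  fixes T :: "'a \<Rightarrow> real"
  assumes [measurable]: "T \<in> borel_measurable M" and "0 < c"
    and small: "\<And>n. n \<ge> N \<Longrightarrow>
      prob {x \<in> space M. real n < T x \<and> T x \<le> real n + 1} \<le> exp (- c * real n)"
  shows "ereal c \<le> tail_rate_sup M T"
proof -
  define q where "q = exp (- c)"
  have q: "0 < q" "q < 1" using \<open>0 < c\<close> by (auto simp: q_def)
  \<comment> \<open>The factor \<open>1 / (1 - q)\<close> is the geometric sum; \<open>exp c\<close>
    pays for rounding \<open>s\<close> down to an integer.\<close>
  define K where "K = exp c / (1 - q)"
  have K: "0 < K" using q by (simp add: K_def)
  have tail_nat: "prob {x \<in> space M. real n < T x} \<le> exp (- c * real n) / (1 - q)" if "n \<ge> N" for n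
  proof -
    let ?A = "\<lambda>k. {x \<in> space M. real (n + k) < T x \<and> T x \<le> real (n + k) + 1}"
    have eq: "exp (- c * real (n + k)) = exp (- c * real n) * q ^ k" for k
      by (simp add: q_def algebra_simps flip: exp_add exp_of_nat_mult)
    have geo: "(\<lambda>k. exp (- c * real n) * q ^ k) sums (exp (- c * real n) * (1 / (1 - q)))"
      using q by (intro sums_mult geometric_sums) simp
    have le: "prob (?A k) \<le> exp (- c * real n) * q ^ k" for k
      using small[of "n + k"] that unfolding eq[symmetric] by simp
    have summ: "summable (\<lambda>k. prob (?A k))"
      by (rule summable_comparison_test[OF _ sums_summable[OF geo]]) (use le in auto)
    have "{x \<in> space M. real n < T x} \<subseteq> (\<Union>k. ?A k)"
    proof
      fix x assume x: "x \<in> {x \<in> space M. real n < T x}"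
      \<comment> \<open>The windows are open on the left and closed on the right, so the one
        containing \<open>T x\<close> starts at the ceiling minus 1, also when \<open>T x\<close> is
        an integer.\<close>
      define j where "j = nat (\<lceil>T x\<rceil> - 1)"
      have "int n < \<lceil>T x\<rceil>" using x by (simp add: less_ceiling_iff)
      then have "n \<le> j" "real j = real_of_int \<lceil>T x\<rceil> - 1" unfolding j_def by linarith+
      moreover have "real_of_int \<lceil>T x\<rceil> - 1 < T x" "T x \<le> real_of_int \<lceil>T x\<rceil>" by linarith+
      ultimately have "x \<in> ?A (j - n)" using x by simp
      then show "x \<in> (\<Union>k. ?A k)" by blast
    qed
    then have "prob {x \<in> space M. real n < T x} \<le> prob (\<Union>k. ?A k)"
      by (intro finite_measure_mono) auto
    also have "\<dots> \<le> (\<Sum>k. prob (?A k))"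
      by (intro finite_measure_subadditive_countably summ) auto
    also have "\<dots> \<le> (\<Sum>k. exp (- c * real n) * q ^ k)"
      by (intro suminf_le le summ sums_summable[OF geo])
    also have "\<dots> = exp (- c * real n) / (1 - q)" using sums_unique[OF geo] by simp
    finally show ?thesis .
  qed
  \<comment> \<open>The constant contributes only \<open>ln K / s\<close>, which vanishes in the
    limit. Requiring \<open>s\<close> to be at least \<open>real N + 1\<close> keeps
    \<open>s\<close> positive even for \<open>N = 0\<close>.\<close>
  have tail: "ereal (1 / s) * eln (emeasure M {x \<in> space M. s < T x}) \<le> ereal (ln K / s - c)"
    if s: "s \<ge> real N + 1" for s
  proof -
    define n where "n = nat \<lfloor>s\<rfloor>"
    have n: "real n \<le> s" "s \<le> real n + 1" "N \<le> n" using s unfolding n_def by linarith+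
    have "prob {x \<in> space M. s < T x} \<le> prob {x \<in> space M. real n < T x}"
      using n by (intro finite_measure_mono) auto
    also have "\<dots> \<le> exp (- c * real n) / (1 - q)" by (rule tail_nat[OF n(3)])
    also have "\<dots> \<le> exp (c - c * s) / (1 - q)"
    proof -
      have "c * s \<le> c * (real n + 1)" using n \<open>0 < c\<close> by (intro mult_left_mono) auto
      then show ?thesis using q by (intro divide_right_mono) (auto simp: algebra_simps)
    qed
    also have "\<dots> = K * exp (- c * s)" by (simp add: K_def exp_diff exp_minus field_simps)
    finally have "emeasure M {x \<in> space M. s < T x} \<le> ennreal (K * exp (- c * s))"
      by (simp add: emeasure_eq_measure ennreal_leI)
    then have "eln (emeasure M {x \<in> space M. s < T x}) \<le> eln (ennreal (K * exp (- c * s)))"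
      by (rule eln_mono)
    also have "\<dots> = ereal (ln K - c * s)" using K by (simp add: eln_ennreal ln_mult)
    finally have "ereal (1 / s) * eln (emeasure M {x \<in> space M. s < T x})
        \<le> ereal (1 / s) * ereal (ln K - c * s)"
      using s by (intro ereal_mult_left_mono) auto
    also have "\<dots> = ereal (ln K / s - c)" using s by (simp add: field_simps)
    finally show ?thesis .
  qed
  have "((\<lambda>s. ln K / s - c) \<longlongrightarrow> 0 - c) at_top"
    by (intro tendsto_diff tendsto_const real_tendsto_divide_at_top[OF tendsto_const filterlim_ident])
  then have "((\<lambda>s. ereal (ln K / s - c)) \<longlongrightarrow> ereal (- c)) at_top" by simp
  then have lim: "Limsup at_top (\<lambda>s. ereal (ln K / s - c)) = ereal (- c)"
    by (intro lim_imp_Limsup) auto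
  have "Limsup at_top (\<lambda>s. ereal (1 / s) * eln (emeasure M {x \<in> space M. s < T x}))
      \<le> Limsup at_top (\<lambda>s. ereal (ln K / s - c))"
    by (intro Limsup_mono) (rule eventually_mono[OF eventually_ge_at_top[of "real N + 1"] tail])
  then have "Limsup at_top (\<lambda>s. ereal (1 / s) * eln (emeasure M {x \<in> space M. s < T x})) \<le> ereal (- c)"
    unfolding lim .
  then show ?thesis
    unfolding tail_rate_sup_def by (subst ereal_minus_le_minus[symmetric]) simp
qed

text \<open>Logarithms of probabilities are at most 0. The sign makes every real number above the
  tail rate positive, and it keeps the products \<open>ereal (1 - \<beta>) * l\<close>
  nonnegative.\<close>

lemma tail_rate_sup_nonneg: "0 \<le> tail_rate_sup M T"
proof -
  have "ereal (1 / s) * eln (emeasure M {x \<in> space M. s < T x}) \<le> 0" if "s > 0" for s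
  proof -
    have "eln (emeasure M {x \<in> space M. s < T x}) \<le> eln (ennreal 1)"
      by (intro eln_mono) (simp add: measure_le_1 emeasure_eq_measure)
    then have "eln (emeasure M {x \<in> space M. s < T x}) \<le> 0"
      by (simp add: eln_ennreal zero_ereal_def del: ennreal_1)
    then have "ereal (1 / s) * eln (emeasure M {x \<in> space M. s < T x}) \<le> ereal (1 / s) * 0"
      using that by (intro ereal_mult_left_mono) auto
    then show ?thesis by simp
  qed
  then have "Limsup at_top (\<lambda>s. ereal (1 / s) * eln (emeasure M {x \<in> space M. s < T x})) \<le> 0"
    by (intro Limsup_bounded) (rule eventually_mono[OF eventually_gt_at_top[of 0]])
  then show ?thesis
    unfolding tail_rate_sup_def by (subst ereal_minus_le_minus[symmetric]) simp
qed

lemma tail_rate_sup_le_inf: "tail_rate_sup M T \<le> tail_rate_inf M T"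
  unfolding tail_rate_sup_def tail_rate_inf_def by (simp add: Liminf_le_Limsup)

section \<open>Points of low cost near (1, 0)\<close>

text \<open>On a late window the mean of \<open>T\<close> is close to \<open>n\<close>, while the
  mean of \<open>Y\<close> is small compared with \<open>n\<close> by \<open>dom\<close>, the
  epsilon form of \<open>norm Y = o(T)\<close>. The Jensen bound charges less than
  \<open>c * n\<close> for this mean, and dividing by \<open>n\<close> gives the point
  sought.\<close>

lemma scaled_cramer_rate_near_axis:
  fixes T :: "'a \<Rightarrow> real" and Y :: "'a \<Rightarrow> 'b::{banach, second_countable_topology}"
  assumes [measurable]: "T \<in> borel_measurable M" "Y \<in> borel_measurable M"
    and dom: "\<And>\<epsilon>. 0 < \<epsilon> \<Longrightarrow> \<exists>R. AE x in M. R < T x \<longrightarrow> norm (Y x) \<le> \<epsilon> * T x"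
    and c: "tail_rate_sup M T < ereal c" and "0 < \<eta>"
  obtains s v \<gamma> where "\<bar>s - 1\<bar> < \<eta>" "norm v < \<eta>" "0 < \<gamma>"
    "ereal \<gamma> * cramer_rate M T Y (s / \<gamma>) (v /\<^sub>R \<gamma>) \<le> ereal c"
proof -
  have "0 < c" using tail_rate_sup_nonneg[of T] c by (metis ereal_less(2) le_less_trans)
  obtain R where R: "AE x in M. R < T x \<longrightarrow> norm (Y x) \<le> \<eta> / 3 * T x"
    using dom[of "\<eta> / 3"] \<open>0 < \<eta>\<close> by auto
  \<comment> \<open>Beyond \<open>R\<close> the domination holds on the whole window,
    \<open>1\<close> permits division by \<open>n\<close>, and \<open>2 / \<eta>\<close> makes the
    window width small after this division.\<close>
  define N where "N = nat \<lceil>max (max R 1) (2 / \<eta>)\<rceil>"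
  obtain n where n: "n \<ge> N"
    and big: "exp (- c * real n) < prob {x \<in> space M. real n < T x \<and> T x \<le> real n + 1}"
    using tail_rate_sup_ge[of T c N] \<open>0 < c\<close> c by (meson assms(1) not_le)
  have nR: "R \<le> real n" "1 \<le> real n" "2 / \<eta> \<le> real n"
    using n unfolding N_def by linarith+
  define A where "A = {x \<in> space M. real n < T x \<and> T x \<le> real n + 1}"
  have A[measurable]: "A \<in> sets M" unfolding A_def by measurable
  have pA: "0 < prob A" using big by (simp add: A_def less_trans[OF exp_gt_zero])
  have A1: "integrable M (\<lambda>x. indicator A x * a)" "(\<integral>x. indicator A x * a \<partial>M) = a * prob A" for a :: real
    by (auto simp: less_top[symmetric])
  have bY: "AE x in M. norm (indicator A x *\<^sub>R Y x) \<le> indicator A x * (\<eta> / 3 * (real n + 1))"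
    using R
  proof eventually_elim
    case (elim x)
    show ?case
    proof (cases "x \<in> A")
      case True
      then have "norm (Y x) \<le> \<eta> / 3 * T x" "T x \<le> real n + 1"
        using elim nR by (auto simp: A_def)
      then have "norm (Y x) \<le> \<eta> / 3 * (real n + 1)"
        using \<open>0 < \<eta>\<close> by (meson order_trans mult_left_mono divide_nonneg_nonneg less_imp_le zero_le_numeral)
      then show ?thesis using True by simp
    qed simp
  qed
  \<comment> \<open>Both variables are bounded almost everywhere on the window, so conditional means
    exist without any moment assumption.\<close>
  have iT: "set_integrable M A T"
    unfolding set_integrable_def
    by (rule Bochner_Integration.integrable_bound[OF A1(1)[of "real n + 1"]])
       (auto simp: A_def indicator_def)
  have iY: "set_integrable M A Y"
    unfolding set_integrable_def
    by (rule Bochner_Integration.integrable_bound[OF A1(1)[of "\<eta> / 3 * (real n + 1)"]])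
       (use bY in \<open>auto elim!: eventually_mono\<close>)
  define s where "s = (LINT x:A|M. T x) / prob A"
  define v where "v = (LINT x:A|M. Y x) /\<^sub>R prob A"
  have J: "cramer_rate M T Y s v \<le> ereal (c * real n)"
  proof -
    have "cramer_rate M T Y s v \<le> ereal (- ln (prob A))"
      unfolding s_def v_def by (rule cramer_rate_conditional_mean_le) (use pA iT iY in auto)
    also have "- c * real n \<le> ln (prob A)"
      using big pA unfolding A_def[symmetric] by (subst ln_ge_iff) auto
    then have "ereal (- ln (prob A)) \<le> ereal (c * real n)" by simp
    finally show ?thesis .
  qed
  have "real n * prob A \<le> (LINT x:A|M. T x)"
    unfolding set_lebesgue_integral_def A1(2)[symmetric]
    by (rule integral_mono[OF A1(1) iT[unfolded set_integrable_def]]) (auto simp: A_def indicator_def)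
  then have s1: "real n \<le> s" using pA by (simp add: s_def field_simps)
  have "(LINT x:A|M. T x) \<le> (real n + 1) * prob A"
    unfolding set_lebesgue_integral_def A1(2)[symmetric]
    by (rule integral_mono[OF iT[unfolded set_integrable_def] A1(1)]) (auto simp: A_def indicator_def)
  then have s2: "s \<le> real n + 1" using pA by (simp add: s_def field_simps)
  have "norm (LINT x:A|M. Y x) \<le> (\<integral>x. norm (indicator A x *\<^sub>R Y x) \<partial>M)"
    unfolding set_lebesgue_integral_def by (rule integral_norm_bound)
  also have "\<dots> \<le> \<eta> / 3 * (real n + 1) * prob A"
    unfolding A1(2)[symmetric]
    by (rule integral_mono_AE[OF integrable_norm[OF iY[unfolded set_integrable_def]] A1(1) bY])
  finally have "norm (LINT x:A|M. Y x) \<le> \<eta> / 3 * (real n + 1) * prob A" .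
  then have v: "norm v \<le> \<eta> / 3 * (real n + 1)" using pA by (simp add: v_def field_simps)
  \<comment> \<open>The witnesses are \<open>s / real n\<close>, \<open>v /\<^sub>R real n\<close>
    and \<open>1 / real n\<close>: with this \<open>\<gamma>\<close> the rate is evaluated exactly
    at \<open>(s, v)\<close>. The bound on \<open>v\<close> becomes two thirds of
    \<open>\<eta>\<close> at most, because \<open>n + 1\<close> is at most
    \<open>2 * n\<close>.\<close>
  show ?thesis
  proof
    have "1 / real n < \<eta>" using nR \<open>0 < \<eta>\<close> by (auto simp: field_simps)
    moreover have "0 \<le> s / real n - 1" "s / real n - 1 \<le> 1 / real n"
      using divide_right_mono[OF s1, of "real n"] divide_right_mono[OF s2, of "real n"] nR(2)
      by (simp_all add: add_divide_distrib)
    ultimately show "\<bar>s / real n - 1\<bar> < \<eta>" by linarith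
    have "\<eta> / 3 * (real n + 1) \<le> \<eta> / 3 * (2 * real n)"
      using nR \<open>0 < \<eta>\<close> by (intro mult_left_mono) auto
    also have "\<dots> < \<eta> * real n" using nR \<open>0 < \<eta>\<close> by simp
    finally show "norm (v /\<^sub>R real n) < \<eta>" using v nR by (simp add: field_simps)
    show "0 < 1 / real n" using nR by simp
    have "ereal (1 / real n) * cramer_rate M T Y s v \<le> ereal (1 / real n) * ereal (c * real n)"
      by (intro ereal_mult_left_mono J) simp
    then show "ereal (1 / real n) * cramer_rate M T Y (s / real n / (1 / real n)) (v /\<^sub>R real n /\<^sub>R (1 / real n)) \<le> ereal c"
      using nR by simp
  qed
qed

end

section \<open>Upsilon as a supremum over radii\<close>

text \<open>Shrinking \<open>\<delta>\<close> shrinks the sets over which the infima run, so the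
  expression grows and its one-sided limit at 0 is its supremum. Estimates can then be made for one
  radius at a time.\<close>

lemma Upsilon_eq_SUP:
  "Upsilon M T Y \<beta> w = (SUP \<delta>\<in>{0<..}. INF s\<in>{\<beta> - \<delta><..<\<beta> + \<delta>}. INF v\<in>ball w \<delta>. INF \<gamma>\<in>{0<..}.
          ereal \<gamma> * cramer_rate M T Y (s / \<gamma>) (v /\<^sub>R \<gamma>))" (is "_ = (SUP \<delta>\<in>_. ?g \<delta>)")
proof -
  have anti: "?g d' \<le> ?g d" if "d \<le> d'" for d d'
    using that by (intro INF_superset_mono order_refl) auto
  have "(?g \<longlongrightarrow> (SUP \<delta>\<in>{0<..}. ?g \<delta>)) (at_right 0)"
  proof (rule order_tendstoI)
    fix a assume "a < (SUP \<delta>\<in>{0<..}. ?g \<delta>)"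
    then obtain d where d: "d > 0" "a < ?g d" by (auto simp: less_SUP_iff)
    show "eventually (\<lambda>x. a < ?g x) (at_right 0)"
      using eventually_at_right_less[of "0::real"] eventually_at_right_real[OF d(1)]
      by eventually_elim (use d anti in \<open>force intro: less_le_trans\<close>)
  next
    fix a assume a: "(SUP \<delta>\<in>{0<..}. ?g \<delta>) < a"
    show "eventually (\<lambda>x. ?g x < a) (at_right 0)"
      using eventually_at_right_less[of "0::real"]
      by eventually_elim (rule le_less_trans[OF SUP_upper a], simp)
  qed
  then show ?thesis
    unfolding Upsilon_def by (intro tendsto_Lim) auto
qed

lemma (in prob_space) Upsilon_nonneg: "0 \<le> Upsilon M T Y \<beta> w"
  unfolding Upsilon_eq_SUP
  by (rule SUP_upper2[of 1]) (auto intro!: INF_greatest simp: cramer_rate_nonneg)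

lemma Upsilon_less_obtain:
  assumes "Upsilon M T Y \<beta> w < a" "0 < \<delta>"
  obtains s v \<gamma> where "\<bar>s - \<beta>\<bar> < \<delta>" "dist w v < \<delta>" "0 < \<gamma>"
    "ereal \<gamma> * cramer_rate M T Y (s / \<gamma>) (v /\<^sub>R \<gamma>) < a"
proof -
  have "(INF s\<in>{\<beta> - \<delta><..<\<beta> + \<delta>}. INF v\<in>ball w \<delta>. INF \<gamma>\<in>{0<..}.
          ereal \<gamma> * cramer_rate M T Y (s / \<gamma>) (v /\<^sub>R \<gamma>)) < a"
    using assms unfolding Upsilon_eq_SUP by (meson SUP_upper greaterThan_iff le_less_trans)
  then obtain s v \<gamma> where "s \<in> {\<beta> - \<delta><..<\<beta> + \<delta>}" "v \<in> ball w \<delta>" "\<gamma> \<in> {0<..}"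
    "ereal \<gamma> * cramer_rate M T Y (s / \<gamma>) (v /\<^sub>R \<gamma>) < a"
    by (auto simp: INF_less_iff)
  then show ?thesis by (intro that[of s v \<gamma>]) auto
qed

lemma Upsilon_leI:
  assumes "\<And>\<delta>. 0 < \<delta> \<Longrightarrow> \<exists>s v \<gamma>. \<bar>s - \<beta>\<bar> < \<delta> \<and> dist w v < \<delta> \<and> 0 < \<gamma> \<and>
    ereal \<gamma> * cramer_rate M T Y (s / \<gamma>) (v /\<^sub>R \<gamma>) \<le> a"
  shows "Upsilon M T Y \<beta> w \<le> a"
  unfolding Upsilon_eq_SUP
proof (rule SUP_least)
  fix \<delta> :: real assume "\<delta> \<in> {0<..}"
  then obtain s v \<gamma> where "\<bar>s - \<beta>\<bar> < \<delta>" "dist w v < \<delta>" "0 < \<gamma>"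
    "ereal \<gamma> * cramer_rate M T Y (s / \<gamma>) (v /\<^sub>R \<gamma>) \<le> a" using assms[of \<delta>] by auto
  then show "(INF s\<in>{\<beta> - \<delta><..<\<beta> + \<delta>}. INF v\<in>ball w \<delta>. INF \<gamma>\<in>{0<..}.
          ereal \<gamma> * cramer_rate M T Y (s / \<gamma>) (v /\<^sub>R \<gamma>)) \<le> a"
    by (intro INF_lower2[of s] INF_lower2[of v] INF_lower2[of \<gamma>]) auto
qed

section \<open>Comparison of Upsilon at 1 and at \<beta>\<close>

context prob_space
begin

text \<open>Since \<open>(1, w)\<close> is \<open>(\<beta>, w)\<close> plus
  \<open>1 - \<beta>\<close> times \<open>(1, 0)\<close>, sublinearity combines a nearly optimal
  point for the first with a point near \<open>(1, 0)\<close> whose cost is nearly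
  \<open>l\<close>.\<close>

lemma Upsilon_one_le:
  fixes T :: "'a \<Rightarrow> real" and Y :: "'a \<Rightarrow> 'b::{banach, second_countable_topology}"
  assumes meas: "T \<in> borel_measurable M" "Y \<in> borel_measurable M"
    and dom: "\<And>\<epsilon>. 0 < \<epsilon> \<Longrightarrow> \<exists>R. AE x in M. R < T x \<longrightarrow> norm (Y x) \<le> \<epsilon> * T x"
    and \<beta>: "\<beta> \<in> {0..1}" and l: "tail_rate_sup M T \<le> l"
  shows "Upsilon M T Y 1 w \<le> Upsilon M T Y \<beta> w + ereal (1 - \<beta>) * l"
\<comment> \<open>In these cases either the second summand is 0, as
  \<open>0 * \<infinity> = 0\<close> in \<open>ereal\<close>, or the right-hand side is infinite.
  Otherwise all quantities involved are real.\<close>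
proof (cases "\<beta> = 1 \<or> Upsilon M T Y \<beta> w = \<infinity> \<or> l = \<infinity>")
  case True
  moreover have "ereal (1 - \<beta>) * l \<ge> 0"
    using \<beta> order_trans[OF tail_rate_sup_nonneg l] by (intro ereal_0_le_mult) auto
  ultimately show ?thesis
    using \<beta> Upsilon_nonneg[of T Y \<beta> w] by (auto simp: zero_ereal_def[symmetric] ereal_mult_infty one_ereal_def[symmetric])
next
  case False
  define t where "t = 1 - \<beta>"
  have t: "0 < t" "t \<le> 1" using False \<beta> by (auto simp: t_def)
  obtain u where u: "Upsilon M T Y \<beta> w = ereal u"
    using False Upsilon_nonneg[of T Y \<beta> w] by (cases "Upsilon M T Y \<beta> w") auto
  obtain r where r: "l = ereal r"
    using False order_trans[OF tail_rate_sup_nonneg l] by (cases l) auto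
  have "Upsilon M T Y 1 w \<le> ereal (u + t * r) + ereal e" if e: "0 < e" for e
  proof (rule Upsilon_leI)
    fix \<delta> :: real assume \<delta>: "0 < \<delta>"
    \<comment> \<open>Each of the two points receives half of the radius \<open>\<delta>\<close> and
      half of the slack \<open>e\<close>. As \<open>t\<close> is at most 1, scaling the second point
      by \<open>t\<close> does not exceed its share.\<close>
    obtain s v \<gamma> where 1: "\<bar>s - \<beta>\<bar> < \<delta> / 2" "dist w v < \<delta> / 2" "0 < \<gamma>"
      "ereal \<gamma> * cramer_rate M T Y (s / \<gamma>) (v /\<^sub>R \<gamma>) < ereal (u + e / 2)"
      using Upsilon_less_obtain[of M T Y \<beta> w "ereal (u + e / 2)" "\<delta> / 2"] u e \<delta> by auto
    have "tail_rate_sup M T < ereal (r + e / 2)"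
      using l r e by (simp add: le_less_trans)
    then obtain s' v' \<gamma>' where 2: "\<bar>s' - 1\<bar> < \<delta> / 2" "norm v' < \<delta> / 2" "0 < \<gamma>'"
      "ereal \<gamma>' * cramer_rate M T Y (s' / \<gamma>') (v' /\<^sub>R \<gamma>') \<le> ereal (r + e / 2)"
      using scaled_cramer_rate_near_axis[OF meas dom, of "r + e / 2" "\<delta> / 2"] \<delta> by auto
    show "\<exists>s v \<gamma>. \<bar>s - 1\<bar> < \<delta> \<and> dist w v < \<delta> \<and> 0 < \<gamma> \<and>
      ereal \<gamma> * cramer_rate M T Y (s / \<gamma>) (v /\<^sub>R \<gamma>) \<le> ereal (u + t * r) + ereal e"
    proof (intro exI conjI)
      have "s + t * s' - 1 = (s - \<beta>) + t * (s' - 1)" by (simp add: t_def algebra_simps)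
      moreover have "\<bar>t * (s' - 1)\<bar> \<le> \<bar>s' - 1\<bar>" using t by (simp add: abs_mult mult_left_le_one_le)
      ultimately show "\<bar>s + t * s' - 1\<bar> < \<delta>" using 1 2 by linarith
      have "dist w (v + t *\<^sub>R v') \<le> dist w v + norm (t *\<^sub>R v')"
        unfolding dist_norm by (metis diff_diff_eq norm_triangle_ineq4)
      moreover have "norm (t *\<^sub>R v') \<le> norm v'" using t by (simp add: mult_left_le_one_le)
      ultimately show "dist w (v + t *\<^sub>R v') < \<delta>" using 1 2 by linarith
      show "0 < \<gamma> + t * \<gamma>'" using 1 2 t by (simp add: add_pos_pos)
      have "t * (e / 2) \<le> e / 2" using t e by (intro mult_left_le_one_le) auto
      then have "u + e / 2 + t * (r + e / 2) \<le> u + t * r + e"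
        using distrib_left[of t r "e / 2"] by linarith
      then have le: "ereal (u + e / 2 + t * (r + e / 2)) \<le> ereal (u + t * r) + ereal e" by simp
      show "ereal (\<gamma> + t * \<gamma>') *
         cramer_rate M T Y ((s + t * s') / (\<gamma> + t * \<gamma>')) ((v + t *\<^sub>R v') /\<^sub>R (\<gamma> + t * \<gamma>'))
         \<le> ereal (u + t * r) + ereal e"
        by (rule order_trans[OF scaled_cramer_rate_add_le[OF meas 1(3) 2(3) t(1) less_imp_le[OF 1(4)] 2(4)] le])
    qed
  qed
  then have "Upsilon M T Y 1 w \<le> ereal (u + t * r)"
    by (rule ereal_le_epsilon2)
  then show ?thesis using u r by (simp add: t_def)
qed

text \<open>The infimum is attained at \<open>\<beta> = 1\<close>, where the tail term vanishes.
  Allowing any \<open>l\<close> above \<open>tail_rate_sup M T\<close> covers both tail rates at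
  once.\<close>

lemma INF_Upsilon_eq:
  fixes T :: "'a \<Rightarrow> real" and Y :: "'a \<Rightarrow> 'b::{banach, second_countable_topology}"
  assumes "T \<in> borel_measurable M" "Y \<in> borel_measurable M"
    and "\<And>\<epsilon>. 0 < \<epsilon> \<Longrightarrow> \<exists>R. AE x in M. R < T x \<longrightarrow> norm (Y x) \<le> \<epsilon> * T x"
    and "tail_rate_sup M T \<le> l"
  shows "(INF \<beta>\<in>{0..1}. Upsilon M T Y \<beta> w + ereal (1 - \<beta>) * l) = Upsilon M T Y 1 w"
proof (rule antisym)
  show "(INF \<beta>\<in>{0..1}. Upsilon M T Y \<beta> w + ereal (1 - \<beta>) * l) \<le> Upsilon M T Y 1 w"
    by (rule INF_lower2[of 1]) (auto simp: zero_ereal_def[symmetric])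
  show "Upsilon M T Y 1 w \<le> (INF \<beta>\<in>{0..1}. Upsilon M T Y \<beta> w + ereal (1 - \<beta>) * l)"
    by (intro INF_greatest Upsilon_one_le assms)
qed

end

section \<open>Application to the waiting times and rewards\<close>

theorem proposition1p1:
  fixes M :: "'w measure"
    and S :: "nat \<Rightarrow> 'w \<Rightarrow> real"
    and X :: "nat \<Rightarrow> 'w \<Rightarrow> 'a::{banach, second_countable_topology}"
  assumes "prob_space M"
    and iid_indep: "prob_space.indep_vars M (\<lambda>_. borel) (\<lambda>i \<omega>. (S i \<omega>, X i \<omega>)) {1..}"
    and iid_distr: "\<And>i. i \<ge> 1 \<Longrightarrow>
          distr M borel (\<lambda>\<omega>. (S i \<omega>, X i \<omega>)) = distr M borel (\<lambda>\<omega>. (S 1 \<omega>, X 1 \<omega>))"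
    and S_pos: "\<And>i \<omega>. i \<ge> 1 \<Longrightarrow> \<omega> \<in> space M \<Longrightarrow> S i \<omega> > 0"
    and dominated: "\<exists>f :: real \<Rightarrow> real. (\<forall>s\<ge>0. f s > 0) \<and> ((\<lambda>s. f s / s) \<longlongrightarrow> 0) at_top \<and>
          (AE \<omega> in M. norm (X 1 \<omega>) \<le> f (S 1 \<omega>))"
  shows "\<forall>w. rate_inf M (S 1) (X 1) w = Upsilon M (S 1) (X 1) 1 w \<and>
             rate_sup M (S 1) (X 1) w = Upsilon M (S 1) (X 1) 1 w"
proof -
  interpret prob_space M by fact
  \<comment> \<open>The definition of \<open>indep_vars\<close> contains the measurability of each
    pair; the continuous projections pass it on to the components.\<close>
  have pair: "(\<lambda>\<omega>. (S 1 \<omega>, X 1 \<omega>)) \<in> borel_measurable M"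
    using iid_indep unfolding indep_vars_def by auto
  have "fst \<circ> (\<lambda>\<omega>. (S 1 \<omega>, X 1 \<omega>)) \<in> borel_measurable M"
    "snd \<circ> (\<lambda>\<omega>. (S 1 \<omega>, X 1 \<omega>)) \<in> borel_measurable M"
    by (rule measurable_comp[OF pair], intro borel_measurable_continuous_onI continuous_intros)+
  then have meas: "S 1 \<in> borel_measurable M" "X 1 \<in> borel_measurable M"
    by (simp_all add: comp_def)
  obtain f where f: "((\<lambda>s. f s / s) \<longlongrightarrow> 0) at_top" "AE \<omega> in M. norm (X 1 \<omega>) \<le> f (S 1 \<omega>)"
    using dominated by auto
  have dom: "\<exists>R. AE \<omega> in M. R < S 1 \<omega> \<longrightarrow> norm (X 1 \<omega>) \<le> \<epsilon> * S 1 \<omega>" if \<epsilon>: "0 < \<epsilon>" for \<epsilon>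
  proof -
    have "eventually (\<lambda>s. f s / s < \<epsilon>) at_top" using order_tendstoD(2)[OF f(1) \<epsilon>] .
    then obtain R where R: "f s / s < \<epsilon>" if "s \<ge> R" for s
      by (auto simp: eventually_at_top_linorder)
    \<comment> \<open>The maximum with 0 ensures \<open>S 1 \<omega> > 0\<close>, so the bound on
      \<open>f s / s\<close> can be multiplied out.\<close>
    have "AE \<omega> in M. max R 0 < S 1 \<omega> \<longrightarrow> norm (X 1 \<omega>) \<le> \<epsilon> * S 1 \<omega>"
      using f(2)
    proof eventually_elim
      case (elim \<omega>)
      show ?case
        using R[of "S 1 \<omega>"] elim by (auto simp: field_simps)
    qed
    then show ?thesis by blast
  qed
  \<comment> \<open>An infinite tail rate is settled by the definitions; for a finite one,
    \<open>l\<close> is taken to be each of the two tail rates in turn.\<close>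
  show ?thesis
    using INF_Upsilon_eq[OF meas dom order_refl]
      INF_Upsilon_eq[OF meas dom tail_rate_sup_le_inf]
    by (simp add: rate_inf_def rate_sup_def)
qed

end
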